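(* Let $\gamma^u_-$ and $\gamma^v_-$ be the exterior boundary layers of a bounded domain $\Omega\subset\mathbb R^2$ on the two staggered velocity grids, and let real densities $q^u$ on $\gamma^u_-$ and $q^v$ on $\gamma^v_-$ be given. Then the velocities and associated pressures $$\bm u^u(m)=\sum_{n+e_1/2\in\gamma^u_-}\mathcal S(m,n)\begin{bmatrix} q^u_{n+e_1/2} \\ 0 \end{bmatrix},\qquad p^u(m)=\sum_{n+e_1/2\in\gamma^u_-}\mathcal P(m,n)\begin{bmatrix} q^u_{n+e_1/2} \\ 0 \end{bmatrix}$$ and $$\bm u^v(m)=\sum_{n+e_2/2\in\gamma^v_-}\mathcal S(m,n)\begin{bmatrix} 0 \\ {q^v_{n+e_2/2}} \end{bmatrix},\qquad p^v(m)=\sum_{n+e_2/2\in\gamma^v_-}\mathcal P(m,n)\begin{bmatrix} 0 \\ {q^v_{n+e_2/2}} \end{bmatrix}$$ each satisfy the Stokes difference equations, homogeneous away from the source layers: the two momentum equations with zero right-hand side hold at every velocity node not in $\gamma^u_-\cup\gamma^v_-$, and the discrete divergence equation holds at every cell center. By linearity, so does their sum $(\bm u^u+\bm u^v,\,p^u+p^v)$.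
   Context: Notation. $h>0$ is the grid spacing, $\mu>0$ the viscosity, $m=(m_1,m_2),n=(n_1,n_2)\in\mathbb Z^2$, $e_1=(1,0)$, $e_2=(0,1)$; positions are in units of $h$. Horizontal velocities $u$ live at nodes $m+e_1/2$, vertical velocities $v$ at nodes $m+e_2/2$, pressures at cell centers $m$. A vector $\bm u(m)$ means $(u(m+e_1/2),v(m+e_2/2))^T$. Boundary layers. $M^u_+$ is the set of $u$-velocity nodes inside $\Omega$ and $M^u_-$ the set of exterior $u$-velocity nodes. $N^u_\pm$ is the union of the five-point stencils (a node and its four nearest neighbors on the $u$-grid) over the nodes of $M^u_\pm$. $\gamma^u=N^u_+\cap N^u_-$ and $\gamma^u_\pm=\gamma^u\cap M^u_\pm$. The sets $M^v_\pm,N^v_\pm,\gamma^v,\gamma^v_\pm$ are defined analogously on the $v$-grid. Stokes difference equations with zero right-hand side (MAC scheme): $$-\mu Lu_{m_1+1/2,m_2}+h(p_{m_1+1,m_2}-p_{m_1,m_2})=0,\qquad -\mu Lv_{m_1,m_2+1/2}+h(p_{m_1,m_2+1}-p_{m_1,m_2})=0,$$ $$u_{m_1+1/2,m_2}-u_{m_1-1/2,m_2}+v_{m_1,m_2+1/2}-v_{m_1,m_2-1/2}=0,$$ where $L$ is the unscaled five-point operator, $(L\phi)(m)=\phi(m+e_1)+\phi(m-e_1)+\phi(m+e_2)+\phi(m-e_2)-4\phi(m)$, applied on the respective velocity grid. Kernels. $\mathcal S(m,n)=\mathcal S(m-n)$ and $\mathcal P(m,n)=\mathcal P(m-n)$,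 where, with $D_x^\pm,D_y^\pm,D_{xx},D_{yy}$ the unscaled forward/backward/second differences in the first and second index, $$\mathcal S(m_1,m_2)=-\frac1\mu\begin{bmatrix} D_{yy}H(m_1,m_2) & -D_y^+D_x^+H(m_1,m_2-1)\\ -D_y^+D_x^+H(m_1-1,m_2) & D_{xx}H(m_1,m_2)\end{bmatrix},\qquad \mathcal P(m_1,m_2)=\frac1h\begin{bmatrix} D_x^-G(m_1,m_2)\\ D_y^-G(m_1,m_2)\end{bmatrix},$$ with $\mathcal P$ acting on a source vector $(a,b)^T$ by $\mathcal P_1a+\mathcal P_2b$. Here $G$ is the regularized Laplace lattice Green's function $G(m)=\frac1{4\pi^2}\int_{[-\pi,\pi]^2}\frac{e^{im\cdot\theta}-1}{2\cos\theta_1+2\cos\theta_2-4}\,d\theta$ and $H$ is the regularized biharmonic lattice Green's function given by $$16H(m_1,m_2)=m_1^2\bigl(2G(m_1,m_2)+G(m_1,m_2+1)+G(m_1,m_2-1)\bigr)+m_2^2\bigl(2G(m_1,m_2)+G(m_1+1,m_2)+G(m_1-1,m_2)\bigr)-2G(m_1,m_2).$$ *)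

theory Defs
  imports "HOL-Analysis.Analysis"
begin

text \<open>
  Every grid function has argument \<open>m :: int \<times> int\<close>. On the \<open>u\<close>-grid the index \<open>m\<close> stands for the
  node \<open>m + e\<^sub>1/2\<close>, on the \<open>v\<close>-grid for the node \<open>m + e\<^sub>2/2\<close>, and for pressures for the cell
  center \<open>m\<close>. A velocity field \<open>w :: int \<times> int \<Rightarrow> real^2\<close> has \<open>w m $ 1 = u(m + e\<^sub>1/2)\<close> and
  \<open>w m $ 2 = v(m + e\<^sub>2/2)\<close>. Consequently index sets of the two velocity grids are kept apart and
  never united, although they have the same type.
\<close>

definition e1 :: "int \<times> int" where "e1 = (1, 0)"
definition e2 :: "int \<times> int" where "e2 = (0, 1)"

definition Dx_plus :: "(int \<times> int \<Rightarrow> real) \<Rightarrow> int \<times> int \<Rightarrow> real"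
  where "Dx_plus f m = f (m + e1) - f m"
definition Dx_minus :: "(int \<times> int \<Rightarrow> real) \<Rightarrow> int \<times> int \<Rightarrow> real"
  where "Dx_minus f m = f m - f (m - e1)"
definition Dy_plus :: "(int \<times> int \<Rightarrow> real) \<Rightarrow> int \<times> int \<Rightarrow> real"
  where "Dy_plus f m = f (m + e2) - f m"
definition Dy_minus :: "(int \<times> int \<Rightarrow> real) \<Rightarrow> int \<times> int \<Rightarrow> real"
  where "Dy_minus f m = f m - f (m - e2)"
definition Dxx :: "(int \<times> int \<Rightarrow> real) \<Rightarrow> int \<times> int \<Rightarrow> real"
  where "Dxx f m = f (m + e1) - 2 * f m + f (m - e1)"
definition Dyy :: "(int \<times> int \<Rightarrow> real) \<Rightarrow> int \<times> int \<Rightarrow> real"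
  where "Dyy f m = f (m + e2) - 2 * f m + f (m - e2)"

definition lap5 :: "(int \<times> int \<Rightarrow> real) \<Rightarrow> int \<times> int \<Rightarrow> real"
  where "lap5 f m = f (m + e1) + f (m - e1) + f (m + e2) + f (m - e2) - 4 * f m"


subsection \<open>Lattice Green's functions and kernels\<close>

definition lattice_G_integrand :: "int \<times> int \<Rightarrow> real \<times> real \<Rightarrow> complex"
  where "lattice_G_integrand m \<theta> =
    (exp (\<i> * of_real (of_int (fst m) * fst \<theta> + of_int (snd m) * snd \<theta>)) - 1)
      / of_real (2 * cos (fst \<theta>) + 2 * cos (snd \<theta>) - 4)"

text \<open>The integral is real (see \<open>lattice_G_complex\<close> below), so taking \<open>Re\<close> only changes the type.
  The singularity at \<open>\<theta> = 0\<close> is of order \<open>1/|\<theta>|\<close>, hence integrable in the plane.\<close>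

definition lattice_G :: "int \<times> int \<Rightarrow> real"
  where "lattice_G m =
    Re (1 / (4 * of_real pi ^ 2) *
      (LINT \<theta>:{-pi..pi} \<times> {-pi..pi}|lborel. lattice_G_integrand m \<theta>))"

lemma lattice_G_complex:
  "complex_of_real (lattice_G m) =
    1 / (4 * of_real pi ^ 2) *
      (LINT \<theta>:{-pi..pi} \<times> {-pi..pi}|lborel. lattice_G_integrand m \<theta>)"
proof -
  let ?S = "{-pi..pi} \<times> {-pi..pi}"
  let ?g = "\<lambda>\<theta>::real \<times> real. indicator ?S \<theta> *\<^sub>R lattice_G_integrand m \<theta>"
  have e: "exp (\<i> * of_real (- t)) = cnj (exp (\<i> * of_real t))" for t
    by (simp add: exp_cnj)
  have c: "?g (- \<theta>) = cnj (?g \<theta>)" for \<theta>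
  proof -
    have "lattice_G_integrand m (- \<theta>) = cnj (lattice_G_integrand m \<theta>)"
      using e[of "of_int (fst m) * fst \<theta> + of_int (snd m) * snd \<theta>"]
      by (simp add: lattice_G_integrand_def del: of_real_add of_real_minus of_real_mult)
    moreover have "indicator ?S (- \<theta>) = (indicator ?S \<theta> :: real)"
      by (cases \<theta>) (auto simp: indicator_def)
    ultimately show ?thesis by simp
  qed
  have meas: "?g \<in> borel_measurable borel"
  proof (rule borel_measurable_scaleR)
    show "indicator ?S \<in> borel_measurable borel"
      by (intro borel_measurable_indicator borel_closed closed_Times closed_atLeastAtMost)
    show "lattice_G_integrand m \<in> borel_measurable borel"
      unfolding lattice_G_integrand_def[abs_def]
      by (intro borel_measurable_divide borel_measurable_continuous_onI continuous_intros)
  qed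
  have "integral\<^sup>L lborel ?g = integral\<^sup>L (distr lborel borel uminus) ?g"
    using lborel_affine[of "-1" "0 :: real \<times> real"]
    by (simp add: density_1 flip: one_ennreal_def)
  also have "\<dots> = integral\<^sup>L lborel (\<lambda>\<theta>. ?g (- \<theta>))"
    by (rule integral_distr) (use meas in auto)
  also have "\<dots> = cnj (integral\<^sup>L lborel ?g)"
    unfolding c by (rule Bochner_Integration.integral_cnj)
  finally have "integral\<^sup>L lborel ?g \<in> \<real>"
    by (metis Reals_cnj_iff)
  then obtain r where r: "integral\<^sup>L lborel ?g = of_real r"
    by (auto elim: Reals_cases)
  have "1 / (4 * of_real pi ^ 2) * complex_of_real r = of_real (1 / (4 * pi ^ 2) * r)"
    by simp
  then show ?thesis
    unfolding lattice_G_def set_lebesgue_integral_def r by (metis Re_complex_of_real)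
qed

definition lattice_H :: "int \<times> int \<Rightarrow> real"
  where "lattice_H m =
    ((of_int (fst m))\<^sup>2 *
        (2 * lattice_G m + lattice_G (m + e2) + lattice_G (m - e2))
     + (of_int (snd m))\<^sup>2 *
        (2 * lattice_G m + lattice_G (m + e1) + lattice_G (m - e1))
     - 2 * lattice_G m) / 16"

definition stokeslet :: "real \<Rightarrow> int \<times> int \<Rightarrow> real^2^2"
  where "stokeslet \<mu> m =
    (- 1 / \<mu>) *\<^sub>R vector
      [vector [Dyy lattice_H m, - Dy_plus (Dx_plus lattice_H) (m - e2)],
       vector [- Dy_plus (Dx_plus lattice_H) (m - e1), Dxx lattice_H m]]"

definition pressurelet :: "real \<Rightarrow> int \<times> int \<Rightarrow> real^2"
  where "pressurelet h m = (1 / h) *\<^sub>R vector [Dx_minus lattice_G m, Dy_minus lattice_G m]"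

definition S_kernel :: "real \<Rightarrow> int \<times> int \<Rightarrow> int \<times> int \<Rightarrow> real^2^2"
  where "S_kernel \<mu> m n = stokeslet \<mu> (m - n)"

definition P_kernel :: "real \<Rightarrow> int \<times> int \<Rightarrow> int \<times> int \<Rightarrow> real^2"
  where "P_kernel h m n = pressurelet h (m - n)"


subsection \<open>Boundary layers\<close>

definition u_node :: "real \<Rightarrow> int \<times> int \<Rightarrow> real \<times> real"
  where "u_node h m = (h * (of_int (fst m) + 1/2), h * of_int (snd m))"

definition v_node :: "real \<Rightarrow> int \<times> int \<Rightarrow> real \<times> real"
  where "v_node h m = (h * of_int (fst m), h * (of_int (snd m) + 1/2))"

text \<open>The argument \<open>node\<close> selects the grid (\<open>u_node h\<close> or \<open>v_node h\<close>). Exterior nodes are all nodes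
  not in the (open) domain, so nodes lying exactly on the boundary count as exterior.\<close>

definition M_plus :: "(int \<times> int \<Rightarrow> real \<times> real) \<Rightarrow> (real \<times> real) set \<Rightarrow> (int \<times> int) set"
  where "M_plus node \<Omega> = {m. node m \<in> \<Omega>}"

definition M_minus :: "(int \<times> int \<Rightarrow> real \<times> real) \<Rightarrow> (real \<times> real) set \<Rightarrow> (int \<times> int) set"
  where "M_minus node \<Omega> = {m. node m \<notin> \<Omega>}"

definition stencil :: "int \<times> int \<Rightarrow> (int \<times> int) set"
  where "stencil m = {m, m + e1, m - e1, m + e2, m - e2}"

definition N_plus :: "(int \<times> int \<Rightarrow> real \<times> real) \<Rightarrow> (real \<times> real) set \<Rightarrow> (int \<times> int) set"
  where "N_plus node \<Omega> = (\<Union>m\<in>M_plus node \<Omega>. stencil m)"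

definition N_minus :: "(int \<times> int \<Rightarrow> real \<times> real) \<Rightarrow> (real \<times> real) set \<Rightarrow> (int \<times> int) set"
  where "N_minus node \<Omega> = (\<Union>m\<in>M_minus node \<Omega>. stencil m)"

definition gamma :: "(int \<times> int \<Rightarrow> real \<times> real) \<Rightarrow> (real \<times> real) set \<Rightarrow> (int \<times> int) set"
  where "gamma node \<Omega> = N_plus node \<Omega> \<inter> N_minus node \<Omega>"

definition gamma_minus :: "(int \<times> int \<Rightarrow> real \<times> real) \<Rightarrow> (real \<times> real) set \<Rightarrow> (int \<times> int) set"
  where "gamma_minus node \<Omega> = gamma node \<Omega> \<inter> M_minus node \<Omega>"


subsection \<open>Stokes difference equations (MAC scheme)\<close>

definition u_momentum :: "real \<Rightarrow> real \<Rightarrow> (int \<times> int \<Rightarrow> real^2) \<Rightarrow> (int \<times> int \<Rightarrow> real) \<Rightarrow> int \<times> int \<Rightarrow> bool"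
  where "u_momentum \<mu> h w p m \<longleftrightarrow> - \<mu> * lap5 (\<lambda>k. w k $ 1) m + h * (p (m + e1) - p m) = 0"

definition v_momentum :: "real \<Rightarrow> real \<Rightarrow> (int \<times> int \<Rightarrow> real^2) \<Rightarrow> (int \<times> int \<Rightarrow> real) \<Rightarrow> int \<times> int \<Rightarrow> bool"
  where "v_momentum \<mu> h w p m \<longleftrightarrow> - \<mu> * lap5 (\<lambda>k. w k $ 2) m + h * (p (m + e2) - p m) = 0"

definition divergence_free :: "(int \<times> int \<Rightarrow> real^2) \<Rightarrow> int \<times> int \<Rightarrow> bool"
  where "divergence_free w m \<longleftrightarrow> w m $ 1 - w (m - e1) $ 1 + w m $ 2 - w (m - e2) $ 2 = 0"

text \<open>\<open>A\<close> is a set of \<open>u\<close>-nodes and \<open>B\<close> a set of \<open>v\<close>-nodes. As the two grids are disjoint, a \<open>u\<close>-node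
  lies outside the union of the two layers iff its index is not in \<open>A\<close>; similarly for \<open>v\<close>-nodes
  and \<open>B\<close>.\<close>

definition stokes_away_from ::
    "real \<Rightarrow> real \<Rightarrow> (int \<times> int) set \<Rightarrow> (int \<times> int) set \<Rightarrow>
     (int \<times> int \<Rightarrow> real^2) \<Rightarrow> (int \<times> int \<Rightarrow> real) \<Rightarrow> bool"
  where "stokes_away_from \<mu> h A B w p \<longleftrightarrow>
    (\<forall>m. m \<notin> A \<longrightarrow> u_momentum \<mu> h w p m) \<and>
    (\<forall>m. m \<notin> B \<longrightarrow> v_momentum \<mu> h w p m) \<and>
    (\<forall>m. divergence_free w m)"

end

theory Submission
  imports Defs
begin

text \<open>
  Up to the choice of additive constants, the formula for \<open>H\<close> says that its Fourier symbol is
  \<open>1/\<sigma>\<^sup>2\<close>, where \<open>\<sigma> = 2 cos \<theta>\<^sub>1 + 2 cos \<theta>\<^sub>2 - 4\<close> is the symbol of the five-point operator \<open>L\<close>; hence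
  \<open>L H = G + const\<close>. Once this is known, the momentum equations reduce to \<open>D\<^sub>x\<^sub>x G + D\<^sub>y\<^sub>y G = L G = 0\<close>
  away from the origin, and the divergence equation is an identity for differences of \<open>H\<close>.

  Two facts about \<open>G\<close> need integration: \<open>L G = 0\<close> off the origin, and the discrete rotation
  symmetry \<open>m\<^sub>1 (G(m + e\<^sub>2) - G(m - e\<^sub>2)) = m\<^sub>2 (G(m + e\<^sub>1) - G(m - e\<^sub>1))\<close>. For the latter, integration by
  parts in \<open>\<theta>\<^sub>1\<close> on the left and in \<open>\<theta>\<^sub>2\<close> on the right gives the same integral, whose integrand is
  bounded because the integrand of \<open>G\<close> may first be symmetrized to \<open>(cos m\<^sub>1\<theta>\<^sub>1 cos m\<^sub>2\<theta>\<^sub>2 - 1)/\<sigma>\<close>.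
  From these two facts \<open>L H = G + const\<close> follows by algebra of difference operators: the defect
  \<open>X\<close> of the identity is harmonic on the whole lattice and invariant under translation by \<open>2 e\<^sub>1\<close> and
  \<open>2 e\<^sub>2\<close>, so it is constant.
\<close>

subsection \<open>Elementary estimates for the sine\<close>

lemma abs_sin_nat_mult_le:
  fixes t :: real
  shows "\<bar>sin (real n * t)\<bar> \<le> real n * \<bar>sin t\<bar>"
proof (induction n)
  case (Suc n)
  have "\<bar>sin (real (Suc n) * t)\<bar> = \<bar>sin (real n * t) * cos t + cos (real n * t) * sin t\<bar>"
    by (simp add: algebra_simps sin_add)
  also have "\<dots> \<le> \<bar>sin (real n * t)\<bar> * \<bar>cos t\<bar> + \<bar>cos (real n * t)\<bar> * \<bar>sin t\<bar>"
    by (metis abs_mult abs_triangle_ineq)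
  also have "\<dots> \<le> \<bar>sin (real n * t)\<bar> * 1 + 1 * \<bar>sin t\<bar>"
    by (intro add_mono mult_left_mono mult_right_mono) auto
  finally show ?case
    using Suc by (simp add: distrib_right)
qed simp

lemma abs_sin_int_mult_le:
  fixes t :: real
  shows "\<bar>sin (of_int k * t)\<bar> \<le> \<bar>of_int k\<bar> * \<bar>sin t\<bar>"
proof (cases k)
  case (nonneg n)
  then show ?thesis using abs_sin_nat_mult_le[of n t] by simp
next
  case (neg n)
  have "sin (of_int k * t) = - sin (real (Suc n) * t)"
    unfolding neg of_int_minus of_int_of_nat_eq mult_minus_left sin_minus ..
  then show ?thesis
    using abs_sin_nat_mult_le[of "Suc n" t] unfolding neg by (simp only: abs_minus_cancel of_int_minus of_int_of_nat_eq abs_of_nat)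
qed

text \<open>A weak Jordan inequality. Up to \<open>pi / 3\<close> the derivative
  \<open>cos x - 1 / 2\<close> of \<open>sin t - t / 2\<close> is nonnegative; beyond that point
  \<open>sin t\<close> is at least \<open>sqrt 3 / 2\<close>.\<close>

lemma sin_ge_half:
  fixes t :: real
  assumes "0 \<le> t" "t \<le> pi / 2"
  shows "t / 2 \<le> sin t"
proof (cases "t \<le> pi / 3")
  case True
  have "\<exists>y. ((\<lambda>t. sin t - t / 2) has_real_derivative y) (at x) \<and> 0 \<le> y"
    if "0 \<le> x" "x \<le> t" for x
  proof (intro exI conjI)
    show "((\<lambda>t. sin t - t / 2) has_real_derivative (cos x - 1 / 2)) (at x)"
      by (auto intro!: derivative_eq_intros)
    show "0 \<le> cos x - 1 / 2"
      using cos_monotone_0_pi_le[of x "pi / 3"] that True by (simp add: cos_60)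
  qed
  from DERIV_nonneg_imp_nondecreasing[OF assms(1), of "\<lambda>t. sin t - t / 2", OF this]
  show ?thesis by simp
next
  case False
  \<comment> \<open>The number 1.7 lies between \<open>pi / 2\<close> and \<open>sqrt 3\<close>, so
    it separates \<open>t / 2\<close> from \<open>sin (pi / 3)\<close>.\<close>
  have "sqrt 3 \<ge> 1.7" by (rule real_le_rsqrt) (simp add: power2_eq_square)
  have "sin (pi / 3) \<le> sin t"
    using False assms by (intro sin_monotone_2pi_le) auto
  moreover have "t \<le> 1.7" using assms pi_less_4 pi_approx by simp
  ultimately show ?thesis using \<open>sqrt 3 \<ge> 1.7\<close> by (simp add: sin_60)
qed

lemma abs_sin_half_ge:
  assumes "\<bar>x\<bar> \<le> pi"
  shows "\<bar>x\<bar> / 4 \<le> \<bar>sin (x / 2)\<bar>"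
  using sin_ge_half[of "x / 2"] sin_ge_half[of "- x / 2"] assms
  by (cases "x \<ge> 0") auto

subsection \<open>Integrals over the Brillouin zone\<close>

text \<open>The Fourier symbol of \<^const>\<open>lap5\<close>.\<close>

definition symb :: "real \<Rightarrow> real \<Rightarrow> real"
  where "symb x y = 2 * cos x + 2 * cos y - 4"

lemma symb_eq: "symb x y = - (4 * ((sin (x / 2))\<^sup>2 + (sin (y / 2))\<^sup>2))"
  using cos_double_sin[of "x / 2"] cos_double_sin[of "y / 2"] by (simp add: symb_def)

lemma symb_commute: "symb x y = symb y x"
  by (simp add: symb_def)

text \<open>Along a line with a fixed nonzero coordinate the symbol has no zero, so quotients by it
  are smooth there and can be integrated by elementary calculus.\<close>

lemma symb_neg:
  assumes "x \<in> {-pi..pi}" "x \<noteq> 0"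
  shows "symb x y < 0"
proof -
  have "sin (x / 2) \<noteq> 0" using abs_sin_half_ge[of x] assms by force
  then have "(sin (x / 2))\<^sup>2 > 0" by simp
  then show ?thesis
    unfolding symb_eq neg_less_0_iff_less by (intro mult_pos_pos add_pos_nonneg) auto
qed

abbreviation cell :: "(real \<times> real) set" where "cell \<equiv> {-pi..pi} \<times> {-pi..pi}"

lemma cell_sets: "cell \<in> sets lborel"
  by (simp add: closed_Times)

lemma cell_set_integrable:
  fixes f :: "real \<times> real \<Rightarrow> real"
  assumes "f \<in> borel_measurable borel" "\<And>x y. \<bar>f (x, y)\<bar> \<le> B"
  shows "set_integrable lborel cell f"
  unfolding set_integrable_def
proof (rule integrableI_bounded_set_indicator[where B = B])
  have "compact cell" by (intro compact_Times) auto
  then show "emeasure lborel cell < \<infinity>" by (rule emeasure_compact_finite)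
qed (use assms cell_sets in auto)

lemma cell_integral_fst:
  fixes f :: "real \<times> real \<Rightarrow> real"
  assumes "set_integrable lborel cell f"
  shows "(LINT z:cell|lborel. f z) = (LINT x:{-pi..pi}|lborel. LINT y:{-pi..pi}|lborel. f (x, y))"
proof -
  have "(LINT z:cell|lborel. f z) = integral\<^sup>L (lborel \<Otimes>\<^sub>M lborel) (\<lambda>z. indicator cell z *\<^sub>R f z)"
    by (simp add: set_lebesgue_integral_def lborel_prod)
  also have "\<dots> = (\<integral>x. \<integral>y. indicator cell (x, y) *\<^sub>R f (x, y) \<partial>lborel \<partial>lborel)"
    using assms by (intro lborel_pair.integral_fst'[symmetric]) (simp add: set_integrable_def lborel_prod)
  finally show ?thesis
    by (simp add: set_lebesgue_integral_def indicator_times mult.assoc)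
qed

lemma cell_swap:
  fixes f :: "real \<times> real \<Rightarrow> real"
  assumes "set_integrable lborel cell f"
  shows "set_integrable lborel cell (\<lambda>(x, y). f (y, x))"
    and "(LINT (x, y):cell|lborel. f (y, x)) = (LINT z:cell|lborel. f z)"
proof -
  have int: "integrable (lborel \<Otimes>\<^sub>M lborel) (\<lambda>z. indicator cell z *\<^sub>R f z)"
    using assms by (simp add: set_integrable_def lborel_prod)
  have eq: "(\<lambda>(x, y). indicator cell (y, x) *\<^sub>R f (y, x)) = (\<lambda>z. indicator cell z *\<^sub>R (case z of (x, y) \<Rightarrow> f (y, x)))"
    by (auto simp: fun_eq_iff indicator_def)
  show "set_integrable lborel cell (\<lambda>(x, y). f (y, x))"
    using lborel_pair.integrable_product_swap[OF int]
    unfolding eq set_integrable_def lborel_prod .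
  show "(LINT (x, y):cell|lborel. f (y, x)) = (LINT z:cell|lborel. f z)"
    using lborel_pair.integral_product_swap[OF borel_measurable_integrable[OF int]]
    unfolding eq set_lebesgue_integral_def lborel_prod .
qed

text \<open>Fubini reduces the claim to single lines. The line \<open>x = 0\<close>, which passes
  through the singularity, is one point of the outer integral and hence a null set.\<close>

lemma cell_integral_zero_snd:
  fixes f :: "real \<times> real \<Rightarrow> real"
  assumes "set_integrable lborel cell f"
    and "\<And>x. x \<in> {-pi..pi} \<Longrightarrow> x \<noteq> 0 \<Longrightarrow> (LINT y:{-pi..pi}|lborel. f (x, y)) = 0"
  shows "(LINT z:cell|lborel. f z) = 0"
proof -
  have "(LINT z:cell|lborel. f z) = (LINT x:{-pi..pi}|lborel. LINT y:{-pi..pi}|lborel. f (x, y))"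
    by (rule cell_integral_fst[OF assms(1)])
  also have "\<dots> = 0"
    unfolding set_lebesgue_integral_def[of lborel "{-pi..pi}" "\<lambda>x. LINT y:{-pi..pi}|lborel. f (x, y)"]
  proof (rule integral_eq_zero_AE)
    show "AE x in lborel. indicator {-pi..pi} x *\<^sub>R (LINT y:{-pi..pi}|lborel. f (x, y)) = 0"
      using AE_lborel_singleton[of 0] by eventually_elim (use assms(2) in \<open>auto simp: indicator_def\<close>)
  qed
  finally show ?thesis .
qed

lemma cell_integral_zero_fst:
  fixes f :: "real \<times> real \<Rightarrow> real"
  assumes "set_integrable lborel cell f"
    and "\<And>y. y \<in> {-pi..pi} \<Longrightarrow> y \<noteq> 0 \<Longrightarrow> (LINT x:{-pi..pi}|lborel. f (x, y)) = 0"
  shows "(LINT z:cell|lborel. f z) = 0"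
  using cell_integral_zero_snd[OF cell_swap(1)[OF assms(1)]] assms(2) cell_swap(2)[OF assms(1)] by simp

text \<open>The form in which integration by parts over a period is used: \<open>F\<close> is the
  boundary term, and its values at the two ends cancel.\<close>

lemma integral_FTC_zero:
  fixes F f :: "real \<Rightarrow> real"
  assumes "\<And>x. x \<in> {-pi..pi} \<Longrightarrow> (F has_real_derivative f x) (at x)"
    and "\<And>x. x \<in> {-pi..pi} \<Longrightarrow> isCont f x"
    and "F pi = F (- pi)"
  shows "(LINT x:{-pi..pi}|lborel. f x) = 0"
  using integral_FTC_Icc_real[of "-pi" pi F f] assms
  by (simp add: set_lebesgue_integral_def mult.commute)

text \<open>Reflection turns the integral into its negative; for a non-integrable \<open>f\<close>
  this agrees with the default value 0 of the integral.\<close>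

lemma integral_odd_zero:
  fixes f :: "real \<Rightarrow> real"
  assumes "\<And>x. f (- x) = - f x"
  shows "(LINT x:{-pi..pi}|lborel. f x) = 0"
proof -
  let ?g = "\<lambda>x. indicator {-pi..pi} x *\<^sub>R f x"
  have *: "?g (0 + - 1 * x) = - ?g x" for x
    using assms[of x] by (auto simp: indicator_def)
  have "integral\<^sup>L lborel ?g = \<bar>-1\<bar> *\<^sub>R (\<integral>x. ?g (0 + - 1 * x) \<partial>lborel)"
    by (rule lborel_integral_real_affine) simp
  also have "\<dots> = - integral\<^sup>L lborel ?g"
    unfolding * by simp
  finally show ?thesis by (simp add: set_lebesgue_integral_def)
qed

subsection \<open>The symmetrized Green's function\<close>

definition green_integrand :: "int \<Rightarrow> int \<Rightarrow> real \<times> real \<Rightarrow> real"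
  where "green_integrand a b z =
    (cos (of_int a * fst z) * cos (of_int b * snd z) - 1) / symb (fst z) (snd z)"

text \<open>This is \<open>4 \<pi>\<^sup>2 G\<close>, see \<open>lattice_G_eq_green\<close> below.\<close>

definition green :: "int \<Rightarrow> int \<Rightarrow> real"
  where "green a b = (LINT z:cell|lborel. green_integrand a b z)"

section \<open>Bounds for quotients by the symbol\<close>

text \<open>At zeros of the symbol, division by zero gives 0, so the bound extends across the
  singularity.\<close>

lemma abs_divide_symb_le:
  assumes "\<bar>n\<bar> \<le> C * (- symb x y)" "0 \<le> C"
  shows "\<bar>n / symb x y\<bar> \<le> C"
proof (cases "symb x y = 0")
  case False
  moreover have "symb x y \<le> 0" by (simp add: symb_eq)
  ultimately show ?thesis using assms by (cases "symb x y < 0") (auto simp: abs_divide field_simps)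
qed (use assms in simp)

lemma one_minus_cos_int_mult_le:
  fixes x :: real
  shows "\<bar>1 - cos (of_int a * x)\<bar> \<le> 2 * (of_int a)\<^sup>2 * (sin (x / 2))\<^sup>2"
proof -
  have "1 - cos (of_int a * x) = 2 * (sin (of_int a * (x / 2)))\<^sup>2"
    using cos_double_sin[of "of_int a * (x / 2)"] by simp
  moreover have "(sin (of_int a * (x / 2)))\<^sup>2 \<le> (of_int a)\<^sup>2 * (sin (x / 2))\<^sup>2"
    using power_mono[OF abs_sin_int_mult_le[of a "x / 2"], of 2] by (simp add: power_mult_distrib)
  ultimately show ?thesis by simp
qed

text \<open>Makes \<open>green_integrand\<close> bounded. The product is telescoped into two terms
  of the form 1 - cos, each of which is twice a squared sine of a half angle.\<close>

lemma cos_cos_minus_one_le: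
  fixes x y :: real
  shows "\<bar>cos (of_int a * x) * cos (of_int b * y) - 1\<bar> \<le> ((of_int a)\<^sup>2 + (of_int b)\<^sup>2) * (- symb x y)"
proof -
  let ?A = "(of_int a :: real)\<^sup>2" and ?B = "(of_int b :: real)\<^sup>2"
  let ?s = "(sin (x / 2))\<^sup>2" and ?t = "(sin (y / 2))\<^sup>2"
  have "\<bar>cos (of_int a * x) * cos (of_int b * y) - 1\<bar>
      = \<bar>(1 - cos (of_int a * x)) + cos (of_int a * x) * (1 - cos (of_int b * y))\<bar>"
    by (simp add: algebra_simps abs_minus_commute)
  also have "\<dots> \<le> \<bar>1 - cos (of_int a * x)\<bar> + \<bar>cos (of_int a * x)\<bar> * \<bar>1 - cos (of_int b * y)\<bar>"
    using abs_triangle_ineq unfolding abs_mult[symmetric] .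
  also have "\<dots> \<le> \<bar>1 - cos (of_int a * x)\<bar> + 1 * \<bar>1 - cos (of_int b * y)\<bar>"
    by (intro add_mono mult_right_mono) auto
  also have "\<dots> \<le> 2 * ?A * ?s + 2 * ?B * ?t"
    using one_minus_cos_int_mult_le[of a x] one_minus_cos_int_mult_le[of b y] by simp
  also have "\<dots> \<le> (?A + ?B) * (4 * (?s + ?t))"
    by (simp add: algebra_simps)
  finally show ?thesis unfolding symb_eq minus_minus .
qed

text \<open>Each sine is at most a multiple of the sine of the half angle, and a product is
  dominated by the sum of squares, which is the symbol up to a factor -4.\<close>

lemma sin_sin_le:
  fixes x y :: real
  shows "\<bar>sin (of_int a * x) * sin (of_int b * y)\<bar> \<le> \<bar>of_int (a * b)\<bar> * (- symb x y)"
proof -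
  have half: "\<bar>sin t\<bar> \<le> 2 * \<bar>sin (t / 2)\<bar>" for t :: real
    using abs_sin_int_mult_le[of 2 "t / 2"] by simp
  have "\<bar>sin (of_int a * x) * sin (of_int b * y)\<bar> \<le> (\<bar>of_int a\<bar> * \<bar>sin x\<bar>) * (\<bar>of_int b\<bar> * \<bar>sin y\<bar>)"
    unfolding abs_mult by (intro mult_mono abs_sin_int_mult_le) auto
  also have "\<dots> \<le> (\<bar>of_int a\<bar> * (2 * \<bar>sin (x / 2)\<bar>)) * (\<bar>of_int b\<bar> * (2 * \<bar>sin (y / 2)\<bar>))"
    by (intro mult_mono mult_left_mono half) auto
  also have "\<dots> = \<bar>of_int (a * b)\<bar> * (4 * (\<bar>sin (x / 2)\<bar> * \<bar>sin (y / 2)\<bar>))"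
    by (simp add: abs_mult)
  also have "\<dots> \<le> \<bar>of_int (a * b)\<bar> * (4 * ((sin (x / 2))\<^sup>2 + (sin (y / 2))\<^sup>2))"
  proof (intro mult_left_mono)
    have "u * v \<le> u\<^sup>2 + v\<^sup>2" if "0 \<le> u" "0 \<le> v" for u v :: real
      using sum_squares_bound[of u v] mult_nonneg_nonneg[OF that] by linarith
    from this[of "\<bar>sin (x / 2)\<bar>" "\<bar>sin (y / 2)\<bar>"]
    show "\<bar>sin (x / 2)\<bar> * \<bar>sin (y / 2)\<bar> \<le> (sin (x / 2))\<^sup>2 + (sin (y / 2))\<^sup>2"
      by simp
  qed auto
  finally show ?thesis unfolding symb_eq minus_minus .
qed

lemma symb_measurable: "(\<lambda>z. symb (fst z) (snd z)) \<in> borel_measurable borel"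
  unfolding symb_def by (intro borel_measurable_continuous_onI continuous_intros)

lemma green_integrand_integrable: "set_integrable lborel cell (green_integrand a b)"
proof (rule cell_set_integrable)
  show "green_integrand a b \<in> borel_measurable borel"
    unfolding green_integrand_def[abs_def]
    by (intro borel_measurable_divide symb_measurable borel_measurable_continuous_onI continuous_intros)
  show "\<bar>green_integrand a b (x, y)\<bar> \<le> (of_int a)\<^sup>2 + (of_int b)\<^sup>2" for x y
    unfolding green_integrand_def fst_conv snd_conv
    by (intro abs_divide_symb_le cos_cos_minus_one_le) auto
qed

lemma sin_sin_integrand_integrable:
  "set_integrable lborel cell (\<lambda>z. sin (of_int a * fst z) * sin (of_int b * snd z) / symb (fst z) (snd z))"
proof (rule cell_set_integrable)
  show "(\<lambda>z. sin (of_int a * fst z) * sin (of_int b * snd z) / symb (fst z) (snd z)) \<in> borel_measurable borel"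
    by (intro borel_measurable_divide symb_measurable borel_measurable_continuous_onI continuous_intros)
  show "\<bar>sin (of_int a * fst (x, y)) * sin (of_int b * snd (x, y)) / symb (fst (x, y)) (snd (x, y))\<bar>
      \<le> \<bar>of_int (a * b)\<bar>" for x y
    unfolding fst_conv snd_conv by (intro abs_divide_symb_le sin_sin_le) auto
qed

lemma green_commute: "green a b = green b a"
proof -
  have "green a b = (LINT (x, y):cell|lborel. green_integrand a b (y, x))"
    unfolding green_def by (rule cell_swap(2)[OF green_integrand_integrable, symmetric])
  also have "(\<lambda>(x, y). green_integrand a b (y, x)) = green_integrand b a"
    by (auto simp: fun_eq_iff green_integrand_def symb_commute mult.commute)
  finally show ?thesis by (simp add: green_def)
qed

section \<open>Harmonicity of the symmetrized Green's function off the origin\<close>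

lemma cos_int_integral:
  assumes "k \<noteq> 0"
  shows "(LINT x:{-pi..pi}|lborel. cos (of_int k * x) * c) = 0"
proof (rule integral_FTC_zero)
  show "((\<lambda>x. sin (of_int k * x) / of_int k * c) has_real_derivative cos (of_int k * x) * c) (at x)" for x
    using assms by (auto intro!: derivative_eq_intros)
  show "sin (of_int k * pi) / of_int k * c = sin (of_int k * - pi) / of_int k * c"
    by (simp add: sin_zero_iff_int2)
qed (auto intro!: continuous_intros)

text \<open>Under the five-point operator the constants -1 cancel and the cosine product is
  multiplied by the symbol. This cancels the denominator, and what remains has mean zero as soon as
  one frequency is nonzero.\<close>

lemma green_harmonic:
  assumes "(a, b) \<noteq> (0, 0)"
  shows "green (a + 1) b + green (a - 1) b + green a (b + 1) + green a (b - 1) - 4 * green a b = 0"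
proof -
  \<comment> \<open>The quotient of the symbol by itself is kept because it is 0, not 1, at zeros of
    the symbol; with it the identity of integrands holds at every point.\<close>
  let ?f = "\<lambda>z. cos (of_int a * fst z) * cos (of_int b * snd z) * (symb (fst z) (snd z) / symb (fst z) (snd z))"
  have "green_integrand (a + 1) b z + green_integrand (a - 1) b z + green_integrand a (b + 1) z
      + green_integrand a (b - 1) z - 4 * green_integrand a b z = ?f z" for z
  proof -
    obtain x y where z: "z = (x, y)" by (cases z)
    have "(cos (of_int (a + 1) * x) * cos (of_int b * y) - 1) + (cos (of_int (a - 1) * x) * cos (of_int b * y) - 1)
        + (cos (of_int a * x) * cos (of_int (b + 1) * y) - 1) + (cos (of_int a * x) * cos (of_int (b - 1) * y) - 1)
        - 4 * (cos (of_int a * x) * cos (of_int b * y) - 1)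
      = cos (of_int a * x) * cos (of_int b * y) * symb x y"
      by (simp add: symb_def cos_add cos_diff ring_distribs)
    moreover have "p / s + q / s + r / s + u / s - 4 * (t / s) = (p + q + r + u - 4 * t) / s" for p q r s t u :: real
      by (simp add: add_divide_distrib diff_divide_distrib)
    ultimately show ?thesis
      unfolding z green_integrand_def fst_conv snd_conv times_divide_eq_right by (simp only:)
  qed
  then have "(LINT z:cell|lborel. ?f z) = (LINT z:cell|lborel. green_integrand (a + 1) b z + green_integrand (a - 1) b z
      + green_integrand a (b + 1) z + green_integrand a (b - 1) z - 4 * green_integrand a b z)"
    by (simp only:)
  also have "\<dots> = green (a + 1) b + green (a - 1) b + green a (b + 1) + green a (b - 1) - 4 * green a b"
    by (simp add: green_def green_integrand_integrable set_integral_add set_integral_diff)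
  finally have "green (a + 1) b + green (a - 1) b + green a (b + 1) + green a (b - 1) - 4 * green a b
      = (LINT z:cell|lborel. ?f z)" ..
  also have "\<dots> = 0"
  proof -
    have int: "set_integrable lborel cell ?f"
    proof (rule cell_set_integrable)
      show "?f \<in> borel_measurable borel"
        by (intro borel_measurable_times borel_measurable_divide symb_measurable borel_measurable_continuous_onI continuous_intros)
      show "\<bar>?f (x, y)\<bar> \<le> 1" for x y
        by (cases "symb x y = 0") (auto simp: abs_mult mult_le_one)
    qed
    show ?thesis
    \<comment> \<open>The inner integration is taken in a variable whose frequency is
      nonzero.\<close>
    proof (cases "b = 0")
      case True
      then have a: "a \<noteq> 0" using assms by simp
      show ?thesis
      proof (rule cell_integral_zero_fst[OF int])
        fix y :: real assume y: "y \<in> {-pi..pi}" "y \<noteq> 0"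
        have "?f (x, y) = cos (of_int a * x) * cos (of_int b * y)" for x
          using symb_neg[OF y, of x] symb_commute[of x y] by simp
        then show "(LINT x:{-pi..pi}|lborel. ?f (x, y)) = 0"
          by (simp only: cos_int_integral[OF a])
      qed
    next
      case False
      show ?thesis
      proof (rule cell_integral_zero_snd[OF int])
        fix x :: real assume x: "x \<in> {-pi..pi}" "x \<noteq> 0"
        have "?f (x, y) = cos (of_int b * y) * cos (of_int a * x)" for y
          using symb_neg[OF x, of y] by simp
        then show "(LINT y:{-pi..pi}|lborel. ?f (x, y)) = 0"
          by (simp only: cos_int_integral[OF False])
      qed
    qed
  qed
  finally show ?thesis .
qed

section \<open>Discrete rotation symmetry\<close>

text \<open>The integrand left after integration by parts. One factor 2 comes from the difference of
  two cosines in \<open>y\<close>, the other from the derivative of the symbol in \<open>x\<close>.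
  It is unchanged when the roles of \<open>(a, x)\<close> and \<open>(b, y)\<close> are
  exchanged.\<close>

definition rotation_integrand :: "int \<Rightarrow> int \<Rightarrow> real \<times> real \<Rightarrow> real"
  where "rotation_integrand a b z =
    4 * ((sin (of_int a * fst z) * sin (fst z)) * (sin (of_int b * snd z) * sin (snd z)))
      / (symb (fst z) (snd z))\<^sup>2"

text \<open>The four sines are regrouped into two products, each pairing a sine in \<open>x\<close>
  with a sine in \<open>y\<close>. By \<open>sin_sin_le\<close> each product is bounded by a
  multiple of the symbol, which matches the squared denominator.\<close>

lemma rotation_integrand_integrable: "set_integrable lborel cell (rotation_integrand a b)"
proof (rule cell_set_integrable)
  show "rotation_integrand a b \<in> borel_measurable borel"
    unfolding rotation_integrand_def[abs_def]
    by (intro borel_measurable_divide borel_measurable_power symb_measurable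
        borel_measurable_continuous_onI continuous_intros)
  show "\<bar>rotation_integrand a b (x, y)\<bar> \<le> 4 * \<bar>of_int (a * b)\<bar>" for x y
  proof -
    have 1: "\<bar>sin x * sin y\<bar> \<le> - symb x y"
      using sin_sin_le[of 1 x 1 y] by simp
    have "\<bar>(sin (of_int a * x) * sin x) * (sin (of_int b * y) * sin y)\<bar>
        = \<bar>sin (of_int a * x) * sin (of_int b * y)\<bar> * \<bar>sin x * sin y\<bar>"
      by (simp add: abs_mult)
    also have "\<dots> \<le> (\<bar>of_int (a * b)\<bar> * - symb x y) * - symb x y"
      using 1 by (intro mult_mono sin_sin_le) (auto intro!: mult_nonneg_nonneg simp: symb_eq)
    finally have *: "\<bar>(sin (of_int a * x) * sin x) * (sin (of_int b * y) * sin y)\<bar>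
        \<le> \<bar>of_int (a * b)\<bar> * (symb x y)\<^sup>2"
      by (simp add: power2_eq_square)
    have "\<bar>rotation_integrand a b (x, y)\<bar> = 4 * \<bar>(sin (of_int a * x) * sin x) * (sin (of_int b * y) * sin y)\<bar> / (symb x y)\<^sup>2"
      unfolding rotation_integrand_def abs_divide fst_conv snd_conv by (simp add: abs_mult)
    also have "\<dots> \<le> 4 * \<bar>of_int (a * b)\<bar>"
      using * by (cases "symb x y = 0") (auto simp: divide_le_eq)
    finally show ?thesis .
  qed
qed

lemma green_rotation_aux:
  "of_int a * (green a (b + 1) - green a (b - 1))
    = (LINT z:cell|lborel. rotation_integrand a b z)"
proof -
  let ?d = "\<lambda>z. of_int a * (green_integrand a (b + 1) z - green_integrand a (b - 1) z)"
  have q: "set_integrable lborel cell (rotation_integrand a b)"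
    by (rule rotation_integrand_integrable)
  have d: "set_integrable lborel cell ?d"
    by (intro set_integrable_mult_right set_integral_diff green_integrand_integrable)
  have "(LINT z:cell|lborel. ?d z - rotation_integrand a b z) = 0"
  proof (rule cell_integral_zero_fst)
    show "set_integrable lborel cell (\<lambda>z. ?d z - rotation_integrand a b z)"
      by (rule set_integral_diff(1)[OF d q])
    fix y :: real assume y: "y \<in> {-pi..pi}" "y \<noteq> 0"
    have nz: "symb x y \<noteq> 0" for x
      using symb_neg[OF y, of x] symb_commute[of x y] by simp
    \<comment> \<open>The boundary term: its derivative in \<open>x\<close> is the difference of the
      two integrands, and it vanishes at both ends because the sine vanishes at integer multiples of
      \<open>pi\<close>.\<close>
    let ?F = "\<lambda>x. - 2 * (sin (of_int b * y) * sin y) * sin (of_int a * x) / symb x y"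
    let ?c = "sin (of_int b * y) * sin y"
    have eq: "?d (x, y) - rotation_integrand a b (x, y) =
        - 2 * ?c * (of_int a * cos (of_int a * x)) / symb x y
        - 4 * ?c * (sin (of_int a * x) * sin x) / (symb x y)\<^sup>2" for x
    proof -
      have "?d (x, y) = of_int a * ((cos (of_int a * x) * cos (of_int (b + 1) * y) - 1
            - (cos (of_int a * x) * cos (of_int (b - 1) * y) - 1)) / symb x y)"
        by (simp only: green_integrand_def fst_conv snd_conv diff_divide_distrib)
      also have "cos (of_int a * x) * cos (of_int (b + 1) * y) - 1
            - (cos (of_int a * x) * cos (of_int (b - 1) * y) - 1) = - 2 * ?c * cos (of_int a * x)"
        by (simp add: distrib_right left_diff_distrib cos_add cos_diff) (simp add: algebra_simps)
      finally show ?thesis by (simp add: rotation_integrand_def mult_ac)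
    qed
    show "(LINT x:{-pi..pi}|lborel. ?d (x, y) - rotation_integrand a b (x, y)) = 0"
      unfolding eq
    proof (rule integral_FTC_zero)
      fix x
      have "(?F has_real_derivative
          (- 2 * ?c * (of_int a * cos (of_int a * x)) * symb x y - (- 2 * ?c * sin (of_int a * x)) * (- 2 * sin x))
            / (symb x y * symb x y)) (at x)"
      proof (rule DERIV_divide)
        show "((\<lambda>x. - 2 * ?c * sin (of_int a * x)) has_real_derivative
            - 2 * ?c * (of_int a * cos (of_int a * x))) (at x)"
          by (auto intro!: derivative_eq_intros)
        show "((\<lambda>x. symb x y) has_real_derivative - 2 * sin x) (at x)"
          unfolding symb_def by (auto intro!: derivative_eq_intros)
        show "symb x y \<noteq> 0" by (rule nz)
      qed
      also have "(- 2 * ?c * (of_int a * cos (of_int a * x)) * symb x y - (- 2 * ?c * sin (of_int a * x)) * (- 2 * sin x))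
            / (symb x y * symb x y) = - 2 * ?c * (of_int a * cos (of_int a * x)) / symb x y
              - 4 * ?c * (sin (of_int a * x) * sin x) / (symb x y)\<^sup>2"
        using nz[of x] by (simp add: diff_divide_distrib power2_eq_square mult_ac)
      finally show "(?F has_real_derivative - 2 * ?c * (of_int a * cos (of_int a * x)) / symb x y
              - 4 * ?c * (sin (of_int a * x) * sin x) / (symb x y)\<^sup>2) (at x)" .
      show "isCont (\<lambda>x. - 2 * ?c * (of_int a * cos (of_int a * x)) / symb x y
              - 4 * ?c * (sin (of_int a * x) * sin x) / (symb x y)\<^sup>2) x"
        using nz[of x] unfolding symb_def by (intro continuous_intros) auto
      show "?F pi = ?F (- pi)"
        by (simp add: mult.commute[of _ pi])
    qed
  qed
  then show ?thesis
    using d q by (simp add: set_integral_diff green_def green_integrand_integrable)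
qed

text \<open>Swapping the coordinates of the cell exchanges \<open>rotation_integrand a b\<close> and
  \<open>rotation_integrand b a\<close>, so \<open>green_rotation_aux\<close> gives both sides the
  same value.\<close>

lemma green_rotation:
  "of_int a * (green a (b + 1) - green a (b - 1)) = of_int b * (green (a + 1) b - green (a - 1) b)"
proof -
  have "(LINT z:cell|lborel. rotation_integrand a b z)
      = (LINT (x, y):cell|lborel. rotation_integrand a b (y, x))"
    by (rule cell_swap(2)[OF rotation_integrand_integrable, symmetric])
  also have "(\<lambda>(x, y). rotation_integrand a b (y, x)) = rotation_integrand b a"
    by (auto simp: fun_eq_iff rotation_integrand_def symb_commute mult_ac)
  finally have "of_int a * (green a (b + 1) - green a (b - 1)) = of_int b * (green b (a + 1) - green b (a - 1))"
    by (simp only: green_rotation_aux)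
  then show ?thesis
    by (simp only: green_commute[of b])
qed

text \<open>
  The complex integrand is only of order \<open>1/|\<theta>|\<close>, so its integrability is not a matter of boundedness.
  It is dominated by a multiple of \<open>|\<theta>\<^sub>1|\<^sup>-\<^sup>1\<^sup>/\<^sup>2 |\<theta>\<^sub>2|\<^sup>-\<^sup>1\<^sup>/\<^sup>2\<close>, a product of integrable functions.
\<close>

lemma integrable_inverse_sqrt_abs:
  "\<exists>k. integrable lborel k \<and> (\<forall>x\<in>{-pi..pi}. x \<noteq> 0 \<longrightarrow> k x = 1 / sqrt \<bar>x\<bar>)"
proof -
  define g where "g x = indicator {0..pi} x *\<^sub>R (x powr (- 1 / 2))" for x :: real
  have "(\<lambda>x::real. x powr (- 1 / 2)) integrable_on {0..pi}"
    by (rule integrable_on_powr_from_0) auto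
  then have "(\<lambda>x::real. x powr (- 1 / 2)) absolutely_integrable_on {0..pi}"
    by (subst absolutely_integrable_on_iff_nonneg) auto
  then have g: "integrable lborel g"
    unfolding set_integrable_def g_def by (subst (asm) integrable_completion) auto
  \<comment> \<open>The reflected copy supplies the values on the negative half of the
    interval.\<close>
  then have "integrable lborel (\<lambda>x. g x + g (0 + - 1 * x))"
    by (intro Bochner_Integration.integrable_add lborel_integrable_real_affine) auto
  moreover have "g x + g (0 + - 1 * x) = 1 / sqrt \<bar>x\<bar>" if "x \<in> {-pi..pi}" "x \<noteq> 0" for x
  proof -
    have "g \<bar>x\<bar> = 1 / sqrt \<bar>x\<bar>"
      using that powr_minus[of "\<bar>x\<bar>" "1 / 2"]
      by (auto simp: g_def powr_half_sqrt inverse_eq_divide)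
    moreover have "g (- \<bar>x\<bar>) = 0" using that by (simp add: g_def)
    ultimately show ?thesis by (cases "x \<ge> 0") auto
  qed
  ultimately show ?thesis by blast
qed

text \<open>With \<open>r\<close> as below, the numerator is at most \<open>2 * K * r\<close> and
  the denominator has modulus \<open>4 * r\<^sup>2\<close>, so the quotient is of order
  \<open>1 / r\<close>. Since \<open>r\<close> dominates the geometric mean of \<open>s\<close> and
  \<open>t\<close>, the bound splits into a product of functions of one variable.\<close>

lemma lattice_G_integrand_bound:
  assumes "x \<in> {-pi..pi}" "x \<noteq> 0" "y \<in> {-pi..pi}" "y \<noteq> 0"
  shows "norm (lattice_G_integrand (a, b) (x, y))
    \<le> 2 * (\<bar>of_int a\<bar> + \<bar>of_int b\<bar>) * ((1 / sqrt \<bar>x\<bar>) * (1 / sqrt \<bar>y\<bar>))"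
proof -
  define K where "K = \<bar>real_of_int a\<bar> + \<bar>of_int b\<bar>"
  define s where "s = \<bar>sin (x / 2)\<bar>"
  define t where "t = \<bar>sin (y / 2)\<bar>"
  define r where "r = sqrt (s\<^sup>2 + t\<^sup>2)"
  define w where "w = sqrt \<bar>x\<bar> * sqrt \<bar>y\<bar>"
  have w: "w > 0" using assms by (simp add: w_def)
  have r2: "r\<^sup>2 = s\<^sup>2 + t\<^sup>2" by (simp add: r_def)
  have "s \<le> r" "t \<le> r"
    by (auto simp: r_def s_def t_def intro!: real_le_rsqrt)
  have "K \<ge> 0" by (simp add: K_def)
  have xs: "\<bar>x\<bar> / 4 \<le> s" and yt: "\<bar>y\<bar> / 4 \<le> t"
    unfolding s_def t_def using assms by (simp_all add: abs_sin_half_ge abs_le_iff del: divide_le_eq_numeral1)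
  have "w / 4 \<le> r"
    unfolding r_def
  proof (rule real_le_rsqrt)
    have "(w / 4)\<^sup>2 = (\<bar>x\<bar> / 4) * (\<bar>y\<bar> / 4)"
      by (simp add: w_def power_mult_distrib power_divide)
    also have "\<dots> \<le> s * t"
      using xs yt by (intro mult_mono) (auto simp: s_def)
    also have "\<dots> \<le> s\<^sup>2 + t\<^sup>2"
      using sum_squares_bound[of s t] mult_nonneg_nonneg[of s t] unfolding s_def t_def by linarith
    finally show "(w / 4)\<^sup>2 \<le> s\<^sup>2 + t\<^sup>2" .
  qed
  then have r: "r > 0" using w by linarith
  let ?\<tau> = "of_int a * x + of_int b * y"
  have "\<bar>sin (?\<tau> / 2)\<bar> = \<bar>sin (of_int a * (x / 2)) * cos (of_int b * (y / 2))
      + cos (of_int a * (x / 2)) * sin (of_int b * (y / 2))\<bar>"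
    by (simp add: add_divide_distrib sin_add)
  also have "\<dots> \<le> \<bar>sin (of_int a * (x / 2))\<bar> * \<bar>cos (of_int b * (y / 2))\<bar>
      + \<bar>cos (of_int a * (x / 2))\<bar> * \<bar>sin (of_int b * (y / 2))\<bar>"
    using abs_triangle_ineq unfolding abs_mult[symmetric] .
  also have "\<dots> \<le> (\<bar>of_int a\<bar> * s) * 1 + 1 * (\<bar>of_int b\<bar> * t)"
    unfolding s_def t_def by (intro add_mono mult_mono abs_sin_int_mult_le) auto
  also have "\<dots> \<le> \<bar>of_int a\<bar> * r + \<bar>of_int b\<bar> * r"
    using \<open>s \<le> r\<close> \<open>t \<le> r\<close> by (simp add: add_mono mult_left_mono)
  finally have sin: "\<bar>sin (?\<tau> / 2)\<bar> \<le> K * r"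
    by (simp add: K_def distrib_right)
  have "norm (lattice_G_integrand (a, b) (x, y)) = 2 * \<bar>sin (?\<tau> / 2)\<bar> / \<bar>symb x y\<bar>"
    unfolding lattice_G_integrand_def norm_divide fst_conv snd_conv dist_exp_i_1 norm_of_real symb_def ..
  also have "\<bar>symb x y\<bar> = 4 * r\<^sup>2"
    unfolding symb_eq r2 by (simp add: s_def t_def)
  also have "2 * \<bar>sin (?\<tau> / 2)\<bar> / (4 * r\<^sup>2) \<le> 2 * (K * r) / (4 * r\<^sup>2)"
    using sin by (intro divide_right_mono) auto
  also have "\<dots> = K / (2 * r)"
    using r by (simp add: power2_eq_square)
  also have "\<dots> \<le> K / (2 * (w / 4))"
    using \<open>w / 4 \<le> r\<close> \<open>K \<ge> 0\<close> w by (intro divide_left_mono) auto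
  also have "\<dots> = 2 * K * ((1 / sqrt \<bar>x\<bar>) * (1 / sqrt \<bar>y\<bar>))"
    by (simp add: w_def)
  finally show ?thesis by (simp only: K_def)
qed

lemma lattice_G_integrand_integrable:
  "set_integrable lborel cell (lattice_G_integrand m)"
proof -
  obtain a b where m: "m = (a, b)" by (cases m)
  obtain k where k: "integrable lborel k" "\<And>x. x \<in> {-pi..pi} \<Longrightarrow> x \<noteq> 0 \<Longrightarrow> k x = 1 / sqrt \<bar>x\<bar>"
    using integrable_inverse_sqrt_abs by blast
  have [measurable]: "k \<in> borel_measurable lborel"
    using k(1) by (rule borel_measurable_integrable)
  have "integrable (lborel \<Otimes>\<^sub>M lborel) (\<lambda>(x, y). k x * k y)"
  proof (rule lborel_pair.Fubini_integrable)
    show "(\<lambda>(x, y). k x * k y) \<in> borel_measurable (lborel \<Otimes>\<^sub>M lborel)"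
      by measurable
    show "integrable lborel (\<lambda>x. \<integral>y. norm (case (x, y) of (x, y) \<Rightarrow> k x * k y) \<partial>lborel)"
      using k(1) by (simp add: abs_mult)
    show "AE x in lborel. integrable lborel (\<lambda>y. case (x, y) of (x, y) \<Rightarrow> k x * k y)"
      using k(1) by simp
  qed
  then have int: "integrable lborel (\<lambda>(x, y). 2 * (\<bar>of_int a\<bar> + \<bar>of_int b\<bar>) * (k x * k y))"
    unfolding lborel_prod case_prod_beta by simp
  have ae: "AE z in lborel. fst z \<noteq> (0::real) \<and> snd z \<noteq> (0::real)"
    unfolding lborel_prod[symmetric]
  proof (rule lborel_pair.AE_pair_measure)
    show "AE x in lborel. AE y in lborel. fst (x, y) \<noteq> (0::real) \<and> snd (x, y) \<noteq> (0::real)"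
      using AE_lborel_singleton[of 0]
    proof eventually_elim
      fix x :: real assume "x \<noteq> 0"
      then show "AE y in lborel. fst (x, y) \<noteq> (0::real) \<and> snd (x, y) \<noteq> (0::real)"
        using AE_lborel_singleton[of "0::real"] by simp
    qed
  qed measurable
  have meas: "(\<lambda>z. indicator cell z *\<^sub>R lattice_G_integrand m z) \<in> borel_measurable lborel"
  proof (rule borel_measurable_scaleR)
    show "indicator cell \<in> borel_measurable lborel"
      using cell_sets by (rule borel_measurable_indicator)
    show "lattice_G_integrand m \<in> borel_measurable lborel"
      unfolding lattice_G_integrand_def[abs_def] measurable_lborel2
      by (intro borel_measurable_divide borel_measurable_continuous_onI continuous_intros)
  qed
  show ?thesis
    unfolding set_integrable_def
  proof (rule Bochner_Integration.integrable_bound[OF int meas])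
    show "AE z in lborel. norm (indicator cell z *\<^sub>R lattice_G_integrand m z)
        \<le> norm (case z of (x, y) \<Rightarrow> 2 * (\<bar>of_int a\<bar> + \<bar>of_int b\<bar>) * (k x * k y))"
      using ae
    proof eventually_elim
      fix z :: "real \<times> real" assume z: "fst z \<noteq> 0 \<and> snd z \<noteq> 0"
      obtain x y where xy: "z = (x, y)" by (cases z)
      show "norm (indicator cell z *\<^sub>R lattice_G_integrand m z)
          \<le> norm (case z of (x, y) \<Rightarrow> 2 * (\<bar>of_int a\<bar> + \<bar>of_int b\<bar>) * (k x * k y))"
      proof (cases "z \<in> cell")
        case True
        then have "x \<in> {-pi..pi}" "y \<in> {-pi..pi}" "x \<noteq> 0" "y \<noteq> 0" using z xy by auto
        then have "norm (lattice_G_integrand m z) \<le> 2 * (\<bar>of_int a\<bar> + \<bar>of_int b\<bar>) * (k x * k y)"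
          using lattice_G_integrand_bound[of x y a b] by (simp add: k(2) m xy)
        also have "\<dots> \<le> norm (case z of (x, y) \<Rightarrow> 2 * (\<bar>of_int a\<bar> + \<bar>of_int b\<bar>) * (k x * k y))"
          by (simp add: xy)
        finally show ?thesis using True by simp
      qed simp
    qed
  qed
qed

text \<open>The real part of the exponential is cos cos - sin sin, and the second product is odd in
  \<open>y\<close>, hence integrates to 0. Integrability of the complex integrand lets
  \<open>Re\<close> pass under the integral.\<close>

lemma lattice_G_eq_green: "lattice_G (a, b) = green a b / (4 * pi\<^sup>2)"
proof -
  let ?ss = "\<lambda>z. sin (of_int a * fst z) * sin (of_int b * snd z) / symb (fst z) (snd z)"
  have "(LINT z:cell|lborel. ?ss z) = 0"
  proof (rule cell_integral_zero_snd[OF sin_sin_integrand_integrable])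
    fix x :: real
    show "(LINT y:{-pi..pi}|lborel. ?ss (x, y)) = 0"
      by (rule integral_odd_zero) (simp add: symb_def)
  qed
  then have "green a b = (LINT z:cell|lborel. green_integrand a b z - ?ss z)"
    by (simp add: green_def set_integral_diff green_integrand_integrable sin_sin_integrand_integrable)
  also have "(\<lambda>z. green_integrand a b z - ?ss z) = (\<lambda>z. Re (lattice_G_integrand (a, b) z))"
  proof
    fix z :: "real \<times> real"
    have "Re (exp (\<i> * of_real t)) = cos t" for t by (simp flip: cis_conv_exp)
    then show "green_integrand a b z - ?ss z = Re (lattice_G_integrand (a, b) z)"
      by (simp add: green_integrand_def lattice_G_integrand_def symb_def cos_add diff_divide_distrib Re_divide_of_real
            del: of_real_add of_real_mult of_real_diff)
  qed
  also have "(LINT z:cell|lborel. Re (lattice_G_integrand (a, b) z))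
      = Re (LINT z:cell|lborel. lattice_G_integrand (a, b) z)"
    using integral_Re[OF lattice_G_integrand_integrable[unfolded set_integrable_def]]
    by (simp add: set_lebesgue_integral_def)
  finally have "green a b = Re (LINT z:cell|lborel. lattice_G_integrand (a, b) z)" .
  moreover have "Re (1 / (4 * of_real pi ^ 2) * z) = Re z / (4 * pi\<^sup>2)" for z :: complex
    using Re_divide_of_real[of z "4 * pi\<^sup>2"] by simp
  ultimately show ?thesis
    unfolding lattice_G_def by simp
qed

subsection \<open>The biharmonic Green's function\<close>

text \<open>Curried counterpart of \<open>lap5\<close>, convenient for exchanging the two
  coordinates.\<close>

definition five_point :: "(int \<Rightarrow> int \<Rightarrow> real) \<Rightarrow> int \<Rightarrow> int \<Rightarrow> real"
  where "five_point g a b = g (a + 1) b + g (a - 1) b + g a (b + 1) + g a (b - 1) - 4 * g a b"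

text \<open>
  The defect \<open>X\<close>: twice this function plus \<open>16 G\<close> equals \<open>16 L H\<close> when \<open>g = G\<close>, see \<open>lap5_lattice_H\<close>.
\<close>

definition euler_defect :: "(int \<Rightarrow> int \<Rightarrow> real) \<Rightarrow> int \<Rightarrow> int \<Rightarrow> real"
  where "euler_defect g a b =
      of_int a * (2 * (g (a + 1) b - g (a - 1) b)
        + (g (a + 1) (b + 1) - g (a - 1) (b + 1)) + (g (a + 1) (b - 1) - g (a - 1) (b - 1)))
    + of_int b * (2 * (g a (b + 1) - g a (b - 1))
        + (g (a + 1) (b + 1) - g (a + 1) (b - 1)) + (g (a - 1) (b + 1) - g (a - 1) (b - 1)))
    - 4 * g a b + g (a + 1) (b + 1) + g (a + 1) (b - 1) + g (a - 1) (b + 1) + g (a - 1) (b - 1)"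

lemma euler_defect_swap: "euler_defect (\<lambda>a b. g b a) b a = euler_defect g a b"
  by (simp add: euler_defect_def)

text \<open>Follows linearly from the two relations at points of the surrounding 3 by 3 block. The
  weight \<open>of_int a\<close> makes the harmonic relation available at the origin too, where
  \<open>five_point g\<close> may be nonzero.\<close>

lemma euler_defect_step2:
  fixes g :: "int \<Rightarrow> int \<Rightarrow> real"
  assumes harmonic: "\<And>a b. of_int a * five_point g a b = 0"
    and rotation: "\<And>a b. of_int a * (g a (b + 1) - g a (b - 1)) = of_int b * (g (a + 1) b - g (a - 1) b)"
  shows "euler_defect g (a + 1) b = euler_defect g (a - 1) b"
  unfolding euler_defect_def
  using rotation[of "a - 1" "b + 1"] rotation[of a "b + 1"] rotation[of "a + 1" "b + 1"]
    rotation[of "a - 1" "b - 1"] rotation[of a "b - 1"] rotation[of "a + 1" "b - 1"]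
    harmonic[of "a - 1" "b + 1"] harmonic[of a "b + 1"] harmonic[of "a + 1" "b + 1"]
    harmonic[of "a - 1" "b - 1"] harmonic[of a "b - 1"] harmonic[of "a + 1" "b - 1"]
    harmonic[of "a - 1" b] harmonic[of a b] harmonic[of "a + 1" b]
  unfolding five_point_def by (simp add: algebra_simps)

lemma five_point_euler_defect:
  fixes g :: "int \<Rightarrow> int \<Rightarrow> real"
  assumes harmonic1: "\<And>a b. of_int a * five_point g a b = 0"
    and harmonic2: "\<And>a b. of_int b * five_point g a b = 0"
  shows "five_point (euler_defect g) a b = 0"
proof -
  let ?K = "\<lambda>a b. of_int a * five_point g a b" and ?M = "\<lambda>a b. of_int b * five_point g a b"
  \<comment> \<open>An identity for every \<open>g\<close>: only differences of the weighted
    Laplacians remain, and these vanish on the whole lattice.\<close>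
  have "five_point (euler_defect g) a b =
      2 * (?K (a + 1) b - ?K (a - 1) b) + (?K (a + 1) (b + 1) - ?K (a - 1) (b + 1))
        + (?K (a + 1) (b - 1) - ?K (a - 1) (b - 1))
      + 2 * (?M a (b + 1) - ?M a (b - 1)) + (?M (a + 1) (b + 1) - ?M (a + 1) (b - 1))
        + (?M (a - 1) (b + 1) - ?M (a - 1) (b - 1))"
    unfolding five_point_def euler_defect_def by (simp add: algebra_simps)
  then show ?thesis
    by (simp only: harmonic1 harmonic2) simp
qed

lemma euler_defect_const:
  fixes g :: "int \<Rightarrow> int \<Rightarrow> real"
  assumes harmonic: "\<And>a b. (a, b) \<noteq> (0, 0) \<Longrightarrow> five_point g a b = 0"
    and rotation: "\<And>a b. of_int a * (g a (b + 1) - g a (b - 1)) = of_int b * (g (a + 1) b - g (a - 1) b)"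
  shows "euler_defect g a b = euler_defect g 0 0"
proof -
  let ?X = "euler_defect g"
  have h: "of_int a * five_point g a b = 0" "of_int b * five_point g a b = 0" for a b
    using harmonic[of a b] by auto
  have x: "?X (a + 1) b = ?X (a - 1) b" for a b
    by (rule euler_defect_step2) (rule h rotation)+
  have y: "?X a (b + 1) = ?X a (b - 1)" for a b
  proof -
    have "euler_defect (\<lambda>a b. g b a) (b + 1) a = euler_defect (\<lambda>a b. g b a) (b - 1) a"
    proof (rule euler_defect_step2)
      show "of_int a * five_point (\<lambda>a b. g b a) a b = 0" for a b
        using h(2)[of a b] by (simp add: five_point_def add_ac)
    qed (rule rotation[symmetric])
    then show ?thesis by (simp only: euler_defect_swap[of g])
  qed
  have l0: "five_point (euler_defect g) a b = 0" for a b
    by (rule five_point_euler_defect) (rule h)+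
  \<comment> \<open>By 2-periodicity opposite neighbors have equal values, so the harmonic relation
    may be halved.\<close>
  have l: "?X (a + 1) b + ?X a (b + 1) = 2 * ?X a b" for a b
    using l0[of a b] x[of a b] y[of a b] unfolding five_point_def by linarith
  have x2: "?X (a + 1 + 1) b = ?X a b" and y2: "?X a (b + 1 + 1) = ?X a b" for a b
    using x[of "a + 1" b] y[of a "b + 1"] by simp_all
  \<comment> \<open>The relation \<open>l\<close> at \<open>(a + 1, b)\<close> and at
    \<open>(a, b + 1)\<close> has the same left side by periodicity, so these two neighbors agree;
    \<open>l\<close> at \<open>(a, b)\<close> then equates them with the center.\<close>
  have step: "?X (a + 1) b = ?X a b" "?X a (b + 1) = ?X a b" for a b
    using l[of a b] l[of "a + 1" b] l[of a "b + 1"] x2[of a b] y2[of a b] by linarith+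
  have "?X a b = ?X 0 b"
  proof (induction a rule: int_induct[where k = 0])
    case (step2 i)
    then show ?case using step(1)[of "i - 1" b] by simp
  qed (simp_all add: step)
  also have "?X 0 b = ?X 0 0"
  proof (induction b rule: int_induct[where k = 0])
    case (step2 i)
    then show ?case using step(2)[of 0 "i - 1"] by simp
  qed (simp_all add: step)
  finally show ?thesis .
qed

section \<open>Transfer to the lattice Green's functions\<close>

lemma lap5_pair: "lap5 f (a, b) = five_point (\<lambda>a b. f (a, b)) a b"
  by (simp add: lap5_def five_point_def e1_def e2_def)

lemma lap5_lattice_H:
  assumes harmonic: "\<And>m. m \<noteq> 0 \<Longrightarrow> lap5 lattice_G m = 0"
    and rotation: "\<And>a b. of_int a * (lattice_G (a, b + 1) - lattice_G (a, b - 1))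
      = of_int b * (lattice_G (a + 1, b) - lattice_G (a - 1, b))"
  shows "\<exists>c. \<forall>m. lap5 lattice_H m = lattice_G m + c"
proof (intro exI allI)
  fix m :: "int \<times> int"
  obtain a b where m: "m = (a, b)" by (cases m)
  let ?g = "\<lambda>a b. lattice_G (a, b)"
  have h: "(a, b) \<noteq> (0, 0) \<Longrightarrow> five_point ?g a b = 0" for a b
    using harmonic[of "(a, b)"] by (simp add: lap5_pair zero_prod_def)
  have k: "of_int a * five_point ?g a b = 0" "of_int b * five_point ?g a b = 0" for a b
    using h[of a b] by auto
  have k2: "(of_int a)\<^sup>2 * five_point ?g a b = 0" "(of_int b)\<^sup>2 * five_point ?g a b = 0" for a b
    using h[of a b] by auto
  \<comment> \<open>In the product rule the squared weights multiply \<open>five_point ?g\<close> at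
    three points in a column and three in a row. These terms vanish, since each weight is zero at
    the origin; the lower-order terms form the defect.\<close>
  have "16 * five_point (\<lambda>a b. lattice_H (a, b)) a b = 16 * ?g a b + 2 * euler_defect ?g a b"
    using k2(1)[of a b] k2(1)[of a "b + 1"] k2(1)[of a "b - 1"]
      k2(2)[of b a] k2(2)[of b "a + 1"] k2(2)[of b "a - 1"]
    unfolding five_point_def euler_defect_def
    by (simp add: lattice_H_def e1_def e2_def field_simps power2_eq_square)
  then show "lap5 lattice_H m = lattice_G m + euler_defect ?g 0 0 / 8"
    using euler_defect_const[of ?g a b, OF h rotation] by (simp add: m lap5_pair)
qed

lemma lap5_lattice_G:
  assumes "m \<noteq> 0"
  shows "lap5 lattice_G m = 0"
proof -
  obtain a b where m: "m = (a, b)" by (cases m)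
  then have "five_point green a b = 0"
    using assms green_harmonic[of a b] by (simp add: five_point_def zero_prod_def)
  moreover have "five_point (\<lambda>a b. lattice_G (a, b)) a b = five_point green a b / (4 * pi\<^sup>2)"
    by (simp add: five_point_def lattice_G_eq_green add_divide_distrib diff_divide_distrib)
  ultimately show ?thesis by (simp add: m lap5_pair)
qed

lemma lattice_G_rotation:
  "of_int a * (lattice_G (a, b + 1) - lattice_G (a, b - 1))
    = of_int b * (lattice_G (a + 1, b) - lattice_G (a - 1, b))"
  using green_rotation[of a b]
  by (simp add: lattice_G_eq_green flip: diff_divide_distrib)

subsection \<open>Solutions of the Stokes difference equations\<close>

lemma lap5_Dyy: "lap5 (Dyy f) m = Dyy (lap5 f) m"
  by (simp add: lap5_def Dyy_def algebra_simps)

lemma lap5_Dxx: "lap5 (Dxx f) m = Dxx (lap5 f) m"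
  by (simp add: lap5_def Dxx_def algebra_simps)

lemma lap5_Dy_Dx: "lap5 (Dy_plus (Dx_plus f)) m = Dy_plus (Dx_plus (lap5 f)) m"
  by (simp add: lap5_def Dx_plus_def Dy_plus_def algebra_simps)

lemma lap5_translate: "lap5 (\<lambda>k. f (k - n)) m = lap5 f (m - n)"
  by (simp add: lap5_def algebra_simps)

lemma lap5_mult: "lap5 (\<lambda>k. c * f k) m = c * lap5 f m"
  by (simp add: lap5_def algebra_simps)

lemma lap5_eq_Dxx_Dyy: "lap5 f m = Dxx f m + Dyy f m"
  by (simp add: lap5_def Dxx_def Dyy_def)

lemma stokes_translate:
  assumes "stokes_away_from \<mu> h A B w p"
  shows "stokes_away_from \<mu> h ((\<lambda>m. m + n) ` A) ((\<lambda>m. m + n) ` B) (\<lambda>m. w (m - n)) (\<lambda>m. p (m - n))"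
proof -
  have *: "m - n \<notin> A" if "m \<notin> (\<lambda>m. m + n) ` A" for m A
    using that by (metis diff_add_cancel image_eqI)
  have "m + v - n = (m - n) + v" "m - v - n = (m - n) - v" for m v
    by (simp_all add: algebra_simps)
  then show ?thesis
    using assms *
    unfolding stokes_away_from_def u_momentum_def v_momentum_def divergence_free_def
    by (simp only: lap5_translate[of "\<lambda>k. w k $ 1"] lap5_translate[of "\<lambda>k. w k $ 2"]) blast
qed

lemma stokes_add:
  assumes "stokes_away_from \<mu> h A B w p" "stokes_away_from \<mu> h A' B' w' p'"
  shows "stokes_away_from \<mu> h (A \<union> A') (B \<union> B') (\<lambda>m. w m + w' m) (\<lambda>m. p m + p' m)"
proof -
  have lap: "lap5 (\<lambda>k. f k + g k) m = lap5 f m + lap5 g m" for f g m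
    by (simp add: lap5_def)
  show ?thesis
    unfolding stokes_away_from_def
  proof (intro conjI allI impI)
    fix m
    show "u_momentum \<mu> h (\<lambda>m. w m + w' m) (\<lambda>m. p m + p' m) m" if "m \<notin> A \<union> A'"
    proof -
      have "u_momentum \<mu> h w p m" "u_momentum \<mu> h w' p' m"
        using assms that unfolding stokes_away_from_def by blast+
      then show ?thesis by (simp add: u_momentum_def lap algebra_simps)
    qed
    show "v_momentum \<mu> h (\<lambda>m. w m + w' m) (\<lambda>m. p m + p' m) m" if "m \<notin> B \<union> B'"
    proof -
      have "v_momentum \<mu> h w p m" "v_momentum \<mu> h w' p' m"
        using assms that unfolding stokes_away_from_def by blast+
      then show ?thesis by (simp add: v_momentum_def lap algebra_simps)
    qed
    have "divergence_free w m" "divergence_free w' m"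
      using assms unfolding stokes_away_from_def by blast+
    then show "divergence_free (\<lambda>m. w m + w' m) m"
      unfolding divergence_free_def vector_add_component by linarith
  qed
qed

text \<open>For infinite \<open>N\<close> both sums take the default value 0, and the zero field
  solves the equations.\<close>

lemma stokes_sum:
  assumes "\<And>n. n \<in> N \<Longrightarrow> stokes_away_from \<mu> h (A n) (B n) (w n) (p n)"
  shows "stokes_away_from \<mu> h (\<Union>n\<in>N. A n) (\<Union>n\<in>N. B n) (\<lambda>m. \<Sum>n\<in>N. w n m) (\<lambda>m. \<Sum>n\<in>N. p n m)"
  using assms
proof (induction N rule: infinite_finite_induct)
  case (insert n N)
  then show ?case by (simp add: stokes_add)
qed (simp_all add: stokes_away_from_def u_momentum_def v_momentum_def divergence_free_def lap5_def)

lemma stokes_mono: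
  assumes "stokes_away_from \<mu> h A B w p" "A \<subseteq> A'" "B \<subseteq> B'"
  shows "stokes_away_from \<mu> h A' B' w p"
  using assms unfolding stokes_away_from_def by blast

section \<open>Fields of a single point source\<close>

text \<open>In the \<open>u\<close>-momentum equation the viscous term gives \<open>Dyy\<close> and
  the pressure term \<open>Dxx\<close> of \<open>q * lattice_G\<close>, whose sum is harmonic off
  the origin. In the \<open>v\<close>-momentum equation the same mixed difference occurs with
  opposite signs, and the divergence cancels because differences commute.\<close>

lemma stokes_point_source_u:
  assumes "h \<noteq> 0" "\<mu> \<noteq> 0"
    and harmonic: "\<And>m. m \<noteq> 0 \<Longrightarrow> lap5 lattice_G m = 0"
    and biharmonic: "\<And>m. lap5 lattice_H m = lattice_G m + c"
  shows "stokes_away_from \<mu> h {0} {} (\<lambda>m. stokeslet \<mu> m *v vector [q, 0])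
    (\<lambda>m. pressurelet h m \<bullet> vector [q, 0])"
proof -
  have w1: "(stokeslet \<mu> m *v vector [q, 0]) $ 1 = - (q / \<mu>) * Dyy lattice_H m"
    and w2: "(stokeslet \<mu> m *v vector [q, 0]) $ 2 = (q / \<mu>) * Dy_plus (Dx_plus lattice_H) (m - e1)"
    and p: "pressurelet h m \<bullet> vector [q, 0] = (q / h) * Dx_minus lattice_G m" for m
    by (simp_all add: stokeslet_def pressurelet_def matrix_vector_mult_def sum_2 inner_vec_def)
  \<comment> \<open>The constant \<open>c\<close> disappears because every entry of the kernel is a
    second difference.\<close>
  have "lap5 lattice_H = (\<lambda>m. lattice_G m + c)" using biharmonic by auto
  then have "lap5 (Dyy lattice_H) m = Dyy lattice_G m"
    "lap5 (Dy_plus (Dx_plus lattice_H)) m = Dy_plus (Dx_plus lattice_G) m" for m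
    by (simp_all add: lap5_Dyy lap5_Dy_Dx) (simp_all add: Dyy_def Dx_plus_def Dy_plus_def)
  note lap = this lap5_mult lap5_translate[of "Dy_plus (Dx_plus lattice_H)"]
  show ?thesis
    unfolding stokes_away_from_def u_momentum_def v_momentum_def divergence_free_def w1 w2 p lap
  proof (intro conjI allI impI)
    fix m :: "int \<times> int"
    show "- \<mu> * (- (q / \<mu>) * Dyy lattice_G m) + h * (q / h * Dx_minus lattice_G (m + e1) - q / h * Dx_minus lattice_G m) = 0"
      if "m \<notin> {0}"
    proof -
      have "Dxx lattice_G m + Dyy lattice_G m = 0"
        using harmonic[of m] that by (simp add: lap5_eq_Dxx_Dyy)
      moreover have "Dxx lattice_G m = Dx_minus lattice_G (m + e1) - Dx_minus lattice_G m"
        by (simp add: Dxx_def Dx_minus_def)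
      ultimately show ?thesis using assms(1,2)
        by (simp add: right_diff_distrib) (simp flip: right_diff_distrib distrib_left add_diff_eq)
    qed
    show "- \<mu> * (q / \<mu> * Dy_plus (Dx_plus lattice_G) (m - e1))
        + h * (q / h * Dx_minus lattice_G (m + e2) - q / h * Dx_minus lattice_G m) = 0"
      using assms(1,2) by (simp add: Dy_plus_def Dx_plus_def Dx_minus_def algebra_simps)
    show "- (q / \<mu>) * Dyy lattice_H m - - (q / \<mu>) * Dyy lattice_H (m - e1)
        + q / \<mu> * Dy_plus (Dx_plus lattice_H) (m - e1) - q / \<mu> * Dy_plus (Dx_plus lattice_H) (m - e2 - e1) = 0"
      by (simp add: Dyy_def Dx_plus_def Dy_plus_def algebra_simps)
  qed
qed
text \<open>The mirror image under exchange of the coordinates: the source now appears in the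
  \<open>v\<close>-momentum equation alone.\<close>

lemma stokes_point_source_v:
  assumes "h \<noteq> 0" "\<mu> \<noteq> 0"
    and harmonic: "\<And>m. m \<noteq> 0 \<Longrightarrow> lap5 lattice_G m = 0"
    and biharmonic: "\<And>m. lap5 lattice_H m = lattice_G m + c"
  shows "stokes_away_from \<mu> h {} {0} (\<lambda>m. stokeslet \<mu> m *v vector [0, q])
    (\<lambda>m. pressurelet h m \<bullet> vector [0, q])"
proof -
  have w1: "(stokeslet \<mu> m *v vector [0, q]) $ 1 = (q / \<mu>) * Dy_plus (Dx_plus lattice_H) (m - e2)"
    and w2: "(stokeslet \<mu> m *v vector [0, q]) $ 2 = - (q / \<mu>) * Dxx lattice_H m"
    and p: "pressurelet h m \<bullet> vector [0, q] = (q / h) * Dy_minus lattice_G m" for m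
    by (simp_all add: stokeslet_def pressurelet_def matrix_vector_mult_def sum_2 inner_vec_def)
  have "lap5 lattice_H = (\<lambda>m. lattice_G m + c)" using biharmonic by auto
  then have "lap5 (Dxx lattice_H) m = Dxx lattice_G m"
    "lap5 (Dy_plus (Dx_plus lattice_H)) m = Dy_plus (Dx_plus lattice_G) m" for m
    by (simp_all add: lap5_Dxx lap5_Dy_Dx) (simp_all add: Dxx_def Dx_plus_def Dy_plus_def)
  note lap = this lap5_mult lap5_translate[of "Dy_plus (Dx_plus lattice_H)"]
  show ?thesis
    unfolding stokes_away_from_def u_momentum_def v_momentum_def divergence_free_def w1 w2 p lap
  proof (intro conjI allI impI)
    fix m :: "int \<times> int"
    show "- \<mu> * (q / \<mu> * Dy_plus (Dx_plus lattice_G) (m - e2))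
        + h * (q / h * Dy_minus lattice_G (m + e1) - q / h * Dy_minus lattice_G m) = 0"
      using assms(1,2) by (simp add: Dy_plus_def Dx_plus_def Dy_minus_def algebra_simps)
    show "- \<mu> * (- (q / \<mu>) * Dxx lattice_G m) + h * (q / h * Dy_minus lattice_G (m + e2) - q / h * Dy_minus lattice_G m) = 0"
      if "m \<notin> {0}"
    proof -
      have "Dxx lattice_G m + Dyy lattice_G m = 0"
        using harmonic[of m] that by (simp add: lap5_eq_Dxx_Dyy)
      moreover have "Dyy lattice_G m = Dy_minus lattice_G (m + e2) - Dy_minus lattice_G m"
        by (simp add: Dyy_def Dy_minus_def)
      ultimately show ?thesis using assms(1,2)
        by (simp add: right_diff_distrib) (simp flip: right_diff_distrib distrib_left add_diff_eq)
    qed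
    show "q / \<mu> * Dy_plus (Dx_plus lattice_H) (m - e2) - q / \<mu> * Dy_plus (Dx_plus lattice_H) (m - e1 - e2)
        + - (q / \<mu>) * Dxx lattice_H m - - (q / \<mu>) * Dxx lattice_H (m - e2) = 0"
      by (simp add: Dxx_def Dx_plus_def Dy_plus_def algebra_simps)
  qed
qed

theorem corollary3p1:
  fixes h \<mu> :: real
    and \<Omega> :: "(real \<times> real) set"
    and qu qv :: "int \<times> int \<Rightarrow> real"
    and wu wv :: "int \<times> int \<Rightarrow> real^2"
    and pu pv :: "int \<times> int \<Rightarrow> real"
  assumes "h > 0" and "\<mu> > 0"
    and "open \<Omega>" and "connected \<Omega>" and "\<Omega> \<noteq> {}" and "bounded \<Omega>"
    and "\<And>m. wu m = (\<Sum>n\<in>gamma_minus (u_node h) \<Omega>. S_kernel \<mu> m n *v vector [qu n, 0])"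
    and "\<And>m. pu m = (\<Sum>n\<in>gamma_minus (u_node h) \<Omega>. P_kernel h m n \<bullet> vector [qu n, 0])"
    and "\<And>m. wv m = (\<Sum>n\<in>gamma_minus (v_node h) \<Omega>. S_kernel \<mu> m n *v vector [0, qv n])"
    and "\<And>m. pv m = (\<Sum>n\<in>gamma_minus (v_node h) \<Omega>. P_kernel h m n \<bullet> vector [0, qv n])"
  shows "stokes_away_from \<mu> h (gamma_minus (u_node h) \<Omega>) (gamma_minus (v_node h) \<Omega>) wu pu
     \<and> stokes_away_from \<mu> h (gamma_minus (u_node h) \<Omega>) (gamma_minus (v_node h) \<Omega>) wv pv
     \<and> stokes_away_from \<mu> h (gamma_minus (u_node h) \<Omega>) (gamma_minus (v_node h) \<Omega>)
           (\<lambda>m. wu m + wv m) (\<lambda>m. pu m + pv m)"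
proof -
  let ?A = "gamma_minus (u_node h) \<Omega>" and ?B = "gamma_minus (v_node h) \<Omega>"
  have nz: "h \<noteq> 0" "\<mu> \<noteq> 0" using assms(1,2) by auto
  obtain c where biharmonic: "\<And>m. lap5 lattice_H m = lattice_G m + c"
    using lap5_lattice_H[OF lap5_lattice_G lattice_G_rotation] by blast
  note source_u = stokes_point_source_u[OF nz lap5_lattice_G biharmonic]
  note source_v = stokes_point_source_v[OF nz lap5_lattice_G biharmonic]
  have "stokes_away_from \<mu> h {n} {} (\<lambda>m. S_kernel \<mu> m n *v vector [qu n, 0])
      (\<lambda>m. P_kernel h m n \<bullet> vector [qu n, 0])" for n
    using stokes_translate[OF source_u, of n] by (simp add: S_kernel_def P_kernel_def)
  then have "stokes_away_from \<mu> h (\<Union>n\<in>?A. {n}) (\<Union>n\<in>?A. {}) wu pu"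
    unfolding assms(7,8)[abs_def] by (rule stokes_sum)
  \<comment> \<open>Sources on the \<open>u\<close>-grid leave no exceptional
    \<open>v\<close>-nodes; the empty set is enlarged to \<open>?B\<close> to match the common form
    of the claim.\<close>
  then have u: "stokes_away_from \<mu> h ?A ?B wu pu"
    by (rule stokes_mono) auto
  have "stokes_away_from \<mu> h {} {n} (\<lambda>m. S_kernel \<mu> m n *v vector [0, qv n])
      (\<lambda>m. P_kernel h m n \<bullet> vector [0, qv n])" for n
    using stokes_translate[OF source_v, of n] by (simp add: S_kernel_def P_kernel_def)
  then have "stokes_away_from \<mu> h (\<Union>n\<in>?B. {}) (\<Union>n\<in>?B. {n}) wv pv"
    unfolding assms(9,10)[abs_def] by (rule stokes_sum)
  then have v: "stokes_away_from \<mu> h ?A ?B wv pv"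
    by (rule stokes_mono) auto
  from u v stokes_add[OF u v] show ?thesis by simp
qed

end
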